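(* Let $1\le N\le M$ be integers, let $z_1,\dots,z_N$ and $\alpha_1,\dots,\alpha_M$ be free variables and $t$ a nonzero free parameter. For every hole configuration $1\le \overline{x_1}<\cdots<\overline{x_N}\le M$, the dual wavefunction $\langle \Phi(z_1,\dots,z_N,\{\alpha\})|\overline{x_1}\cdots\overline{x_N}\rangle$ is expressed by the factorial Schur polynomials as $$\langle \Phi(z_1,\dots,z_N,\{\alpha\})|\overline{x_1}\cdots\overline{x_N}\rangle = t^{N(M-N)}\prod_{1\le j<k\le N}(z_j+tz_k)\; s_{\overline{\lambda}}\Big(\Big\{\frac{z_1}{t},\dots,\frac{z_N}{t}\Big\}\Big|\{-\alpha_1,\dots,-\alpha_M\}\Big),$$ where $\overline{\lambda}=(\overline{\lambda_1},\dots,\overline{\lambda_N})$ is the Young diagram with $\overline{\lambda_j}=\overline{x_{N-j+1}}-N+j-1$, $j=1,\dots,N$.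
   Context: $W_a$ (auxiliary space) and $\mathcal F_j$, $j=1,\dots,M$ (quantum spaces) are copies of $\mathbb C^2$ with basis $|0\rangle,|1\rangle$ and dual basis $\langle 0|,\langle 1|$. The $L$-operator $L_{aj}(z,t,\alpha_j)$ acts on $W_a\otimes\mathcal F_j$ with matrix elements $[L]_{\alpha\beta}^{\gamma\delta}={}_a\langle\gamma|{}_j\langle\delta|L_{aj}(z,t,\alpha_j)|\alpha\rangle_a|\beta\rangle_j$ given by $[L]_{00}^{00}=1$, $[L]_{01}^{01}=t$, $[L]_{10}^{01}=1$, $[L]_{01}^{10}=(t+1)z$, $[L]_{10}^{10}=z+\alpha_j$, $[L]_{11}^{11}=z-t\alpha_j$, and all others $0$. The $B$-operator on $\mathcal F_1\otimes\cdots\otimes\mathcal F_M$ is $B(z,\{\alpha\})={}_a\langle 0|L_{aM}(z,t,\alpha_M)\cdots L_{a1}(z,t,\alpha_1)|1\rangle_a$. $\langle 1\cdots M|={}_1\langle 1|\otimes\cdots\otimes{}_M\langle 1|$. For $1\le\overline{x_1}<\cdots<\overline{x_N}\le M$, $|\overline{x_1}\cdots\overline{x_N}\rangle$ is the basis vector of $\mathcal F_1\otimes\cdots\otimes\mathcal F_M$ whose tensor factor is $|0\rangle$ (hole) at sites $\overline{x_1},\dots,\overline{x_N}$ and $|1\rangle$ at all other sites. The dual wavefunction is $\langle \Phi(z_1,\dots,z_N,\{\alpha\})|\overline{x_1}\cdots\overline{x_N}\rangle=\langle 1\cdots M|B(z_1,\{\alpha\})\cdots B(z_N,\{\alpha\})|\overline{x_1}\cdots\overline{x_N}\rangle$.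 The factorial Schur polynomial for $\lambda=(\lambda_1\ge\cdots\ge\lambda_N\ge0)$ and an ordered list of parameters $\{\alpha\}=\{\alpha_1,\dots,\alpha_M\}$ (with $\lambda_1+N-1\le M$) is $$s_\lambda(\{z\}_N|\{\alpha\})=\frac{F_{\lambda+\delta}(\{z\}_N|\{\alpha\})}{\prod_{1\le j<k\le N}(z_j-z_k)},\qquad F_\mu(\{z\}_N|\{\alpha\})=\det_{1\le i,k\le N}\Big(\prod_{j=1}^{\mu_i}(z_k+\alpha_j)\Big),$$ with $\delta=(N-1,N-2,\dots,0)$. *)

theory Defs
  imports "HOL-Library.FuncSet" "Jordan_Normal_Form.Determinant"
begin

(* Sites, spectral parameters z_1, ..., z_N, parameters alpha_1, ..., alpha_M and the parts of a
   Young diagram are indexed from 1; the values of these functions outside the index range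
   are irrelevant. *)

text \<open>
  Operators are given by their matrix elements in a fixed finite basis \<open>S\<close>, the output
  (bra) label first: \<open>A x y\<close> stands for \<open>\<langle>x|A|y\<rangle>\<close>.
\<close>

type_synonym ('b, 'a) matrix_elems = "'b \<Rightarrow> 'b \<Rightarrow> 'a"

definition op_id :: "('b, 'a::comm_ring_1) matrix_elems" where
  "op_id x y = (if x = y then 1 else 0)"

definition op_mult ::
    "'b set \<Rightarrow> ('b, 'a::comm_ring_1) matrix_elems \<Rightarrow> ('b, 'a) matrix_elems \<Rightarrow> ('b, 'a) matrix_elems" where
  "op_mult S A B x y = (\<Sum>w\<in>S. A x w * B w y)"

text \<open>
  The basis of the product of the two-dimensional quantum spaces at the sites \<open>1, \<dots>, M\<close>
  (\<open>s j\<close> is the label, 0 or 1, of the tensor factor at site \<open>j\<close>), and the basis of the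
  auxiliary space tensored with it.
\<close>

definition q_basis :: "nat \<Rightarrow> (nat \<Rightarrow> nat) set" where
  "q_basis M = (\<Pi>\<^sub>E j\<in>{1..M}. {0, 1})"

definition aq_basis :: "nat \<Rightarrow> (nat \<times> (nat \<Rightarrow> nat)) set" where
  "aq_basis M = {0, 1} \<times> q_basis M"

text \<open>
  \<open>L_elem z t a \<alpha> \<beta> \<gamma> \<delta>\<close> is \<open>[L]\<^sub>\<alpha>\<^sub>\<beta>\<^bsup>\<gamma>\<delta>\<^esup>\<close>: the lower labels \<open>\<alpha>, \<beta>\<close> (auxiliary, quantum) are the
  input and the upper labels \<open>\<gamma>, \<delta>\<close> the output.
\<close>

definition L_elem :: "'a::comm_ring_1 \<Rightarrow> 'a \<Rightarrow> 'a \<Rightarrow> nat \<Rightarrow> nat \<Rightarrow> nat \<Rightarrow> nat \<Rightarrow> 'a" where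
  "L_elem z t a \<alpha> \<beta> \<gamma> \<delta> =
    (if (\<alpha>, \<beta>, \<gamma>, \<delta>) = (0, 0, 0, 0) then 1
     else if (\<alpha>, \<beta>, \<gamma>, \<delta>) = (0, 1, 0, 1) then t
     else if (\<alpha>, \<beta>, \<gamma>, \<delta>) = (1, 0, 0, 1) then 1
     else if (\<alpha>, \<beta>, \<gamma>, \<delta>) = (0, 1, 1, 0) then (t + 1) * z
     else if (\<alpha>, \<beta>, \<gamma>, \<delta>) = (1, 0, 1, 0) then z + a
     else if (\<alpha>, \<beta>, \<gamma>, \<delta>) = (1, 1, 1, 1) then z - t * a
     else 0)"

text \<open>
  The \<open>L\<close>-operator on the auxiliary space and the quantum space at site \<open>j\<close>, extended by the
  identity to the quantum spaces at all other sites.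
\<close>

definition L_op :: "nat \<Rightarrow> 'a \<Rightarrow> 'a \<Rightarrow> 'a \<Rightarrow> nat \<Rightarrow> (nat \<times> (nat \<Rightarrow> nat), 'a::comm_ring_1) matrix_elems" where
  "L_op M z t a j = (\<lambda>(\<gamma>, s') (\<alpha>, s).
     if \<forall>i\<in>{1..M} - {j}. s' i = s i then L_elem z t a \<alpha> (s j) \<gamma> (s' j) else 0)"

text \<open>\<open>L_chain M z t a k\<close> is the product \<open>L\<^sub>a\<^sub>k \<cdots> L\<^sub>a\<^sub>1\<close>, the site-1 operator acting first.\<close>

primrec L_chain ::
    "nat \<Rightarrow> 'a \<Rightarrow> 'a \<Rightarrow> (nat \<Rightarrow> 'a) \<Rightarrow> nat \<Rightarrow> (nat \<times> (nat \<Rightarrow> nat), 'a::comm_ring_1) matrix_elems" where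
  "L_chain M z t a 0 = op_id"
| "L_chain M z t a (Suc k) = op_mult (aq_basis M) (L_op M z t (a (Suc k)) (Suc k)) (L_chain M z t a k)"

definition B_op :: "nat \<Rightarrow> 'a \<Rightarrow> 'a \<Rightarrow> (nat \<Rightarrow> 'a) \<Rightarrow> (nat \<Rightarrow> nat, 'a::comm_ring_1) matrix_elems" where
  "B_op M z t a s' s = L_chain M z t a M (0, s') (1, s)"

text \<open>\<open>B_prod M z t a n\<close> is the product \<open>B(z\<^sub>1) \<cdots> B(z\<^sub>n)\<close>, with \<open>B(z\<^sub>n)\<close> acting first.\<close>

primrec B_prod ::
    "nat \<Rightarrow> (nat \<Rightarrow> 'a) \<Rightarrow> 'a \<Rightarrow> (nat \<Rightarrow> 'a) \<Rightarrow> nat \<Rightarrow> (nat \<Rightarrow> nat, 'a::comm_ring_1) matrix_elems" where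
  "B_prod M z t a 0 = op_id"
| "B_prod M z t a (Suc n) = op_mult (q_basis M) (B_prod M z t a n) (B_op M (z (Suc n)) t a)"

definition full_state :: "nat \<Rightarrow> nat \<Rightarrow> nat" where
  "full_state M = (\<lambda>j\<in>{1..M}. 1)"

definition hole_state :: "nat \<Rightarrow> nat \<Rightarrow> (nat \<Rightarrow> nat) \<Rightarrow> nat \<Rightarrow> nat" where
  "hole_state M N x = (\<lambda>j\<in>{1..M}. if j \<in> x ` {1..N} then 0 else 1)"

definition dual_wavefunction ::
    "nat \<Rightarrow> nat \<Rightarrow> (nat \<Rightarrow> 'a::comm_ring_1) \<Rightarrow> 'a \<Rightarrow> (nat \<Rightarrow> 'a) \<Rightarrow> (nat \<Rightarrow> nat) \<Rightarrow> 'a" where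
  "dual_wavefunction M N z t a x = B_prod M z t a N (full_state M) (hole_state M N x)"

text \<open>Matrices of the library are indexed from 0, hence the shifts by one.\<close>

definition factorial_F :: "nat \<Rightarrow> (nat \<Rightarrow> nat) \<Rightarrow> (nat \<Rightarrow> 'a::comm_ring_1) \<Rightarrow> (nat \<Rightarrow> 'a) \<Rightarrow> 'a" where
  "factorial_F N \<mu> z a = det (mat N N (\<lambda>(i, k). \<Prod>j=1..\<mu> (i + 1). z (k + 1) + a j))"

text \<open>
  The quotient is meaningful only for pairwise distinct \<open>z\<^sub>1, \<dots>, z\<^sub>N\<close>, in particular for
  indeterminates in a field of rational functions; otherwise division by zero makes it 0.
\<close>

definition factorial_schur :: "nat \<Rightarrow> (nat \<Rightarrow> nat) \<Rightarrow> (nat \<Rightarrow> 'a::field) \<Rightarrow> (nat \<Rightarrow> 'a) \<Rightarrow> 'a" where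
  "factorial_schur N \<nu> z a =
     factorial_F N (\<lambda>i. \<nu> i + (N - i)) z a / (\<Prod>k=1..N. \<Prod>j=1..<k. z j - z k)"

text \<open>
  \<open>x\<^sub>N\<^sub>-\<^sub>j\<^sub>+\<^sub>1 - N + j - 1\<close>, regrouped; no truncation occurs for \<open>1 \<le> j \<le> N\<close>, since
  \<open>1 \<le> x\<^sub>1 < \<cdots> < x\<^sub>N\<close> gives \<open>x\<^sub>i \<ge> i\<close>.
\<close>

definition hole_partition :: "nat \<Rightarrow> (nat \<Rightarrow> nat) \<Rightarrow> nat \<Rightarrow> nat" where
  "hole_partition N x j = x (N - j + 1) - (N - j + 1)"

end

theory Submission
  imports Defs
begin

text \<open>
  The operators are written as acting on row vectors. The last site splits off from the monodromy
  matrix, which gives recursions for \<open>B = \<langle>0|T|1\<rangle>\<close> and \<open>D = \<langle>1|T|1\<rangle>\<close>; the column with auxiliary input \<open>1\<close> is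
  closed under them, so the exchange relations of \<open>B\<close> and \<open>D\<close> follow by induction on the number of
  sites, without the full \<open>RTT\<close> relation. A particle at the last site contributes \<open>t\<^sup>N\<close>. A hole at the
  last site means that exactly one factor acts there by \<open>D\<close> on the remaining sites; moving this \<open>D\<close>
  to the left, where the completely filled row vector is an eigenvector of it with eigenvalue
  \<open>\<Prod>\<^sub>j (z - t \<alpha>\<^sub>j)\<close>, produces the Laplace expansion of the determinant along its first row. The
  coefficients of the expansion are collected by a partial fraction identity.
\<close>

section \<open>Scalar identities behind the exchange relations\<close>

text \<open>These are the nontrivial induction steps for, in order: BB at a hole, DD at a particle,
  DB at a hole, DB at a particle. Up to the choice of row vector u, \<open>P\<close> and
  \<open>X\<close> are u B(z) D(w) and u D(z) B(w), \<open>Q\<close> and \<open>Y\<close> are these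
  with z and w swapped, \<open>K\<close> is u B(z) B(w), \<open>K'\<close> its swap, and
  \<open>E\<close> is u D(z) D(w). Multiplying by \<open>t * (z - w)\<close> lets the hypotheses
  eliminate \<open>P\<close> and \<open>Q\<close>.\<close>

lemma exchange_algebra:
  fixes z w t b P Q X Y E K K' :: "'a::field"
  assumes "t * (z - w) \<noteq> 0"
    and DB: "t * (z - w) * P = (1 + t) * w * X - (z + t * w) * Y"
    and DB': "t * (w - z) * Q = (1 + t) * z * Y - (w + t * z) * X"
    and BB: "(w + t * z) * K = (z + t * w) * K'"
  shows "(w + t * z) * (K + X + t * P) = (z + t * w) * (K' + Y + t * Q)"
    and "(w - t * b) * ((z - t * b) * E + (t + 1) * z * P) + (t + 1) * w * ((z + b) * X)
      = (z - t * b) * ((w - t * b) * E + (t + 1) * w * Q) + (t + 1) * z * ((w + b) * Y)"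
    and "t * (z - w) * ((w + b) * (P + E))
      = (1 + t) * w * ((z + b) * X + ((z - t * b) * E + (t + 1) * z * P))
        - (z + t * w) * ((w + b) * Y + ((w - t * b) * E + (t + 1) * w * Q))"
    and "t * (z - w) * ((w - t * b) * (t * P) + (t + 1) * w * (K + X))
      = (1 + t) * w * (t * ((z - t * b) * X + (t + 1) * z * K))
        - (z + t * w) * (t * ((w - t * b) * Y + (t + 1) * w * K'))"
proof -
  have cancel: "p = q" if "t * (z - w) * (p - q) = 0" for p q
    using that assms(1) by simp
  show "(w + t * z) * (K + X + t * P) = (z + t * w) * (K' + Y + t * Q)"
  proof (rule cancel)
    have "t * (z - w) * ((w + t * z) * (K + X + t * P) - (z + t * w) * (K' + Y + t * Q))
      = t * (z - w) * ((w + t * z) * K - (z + t * w) * K')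
        + t * (w + t * z) * (t * (z - w) * P) + t * (z + t * w) * (t * (w - z) * Q)
        + t * (z - w) * ((w + t * z) * X - (z + t * w) * Y)"
      by (simp add: algebra_simps)
    also have "\<dots> = 0"
      unfolding DB DB' BB by (simp add: algebra_simps)
    finally show "t * (z - w) * ((w + t * z) * (K + X + t * P) - (z + t * w) * (K' + Y + t * Q)) = 0" .
  qed
  show "(w - t * b) * ((z - t * b) * E + (t + 1) * z * P) + (t + 1) * w * ((z + b) * X)
      = (z - t * b) * ((w - t * b) * E + (t + 1) * w * Q) + (t + 1) * z * ((w + b) * Y)"
  proof (rule cancel)
    have "t * (z - w) * ((w - t * b) * ((z - t * b) * E + (t + 1) * z * P) + (t + 1) * w * ((z + b) * X)
        - ((z - t * b) * ((w - t * b) * E + (t + 1) * w * Q) + (t + 1) * z * ((w + b) * Y)))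
      = (w - t * b) * (t + 1) * z * (t * (z - w) * P) + (z - t * b) * (t + 1) * w * (t * (w - z) * Q)
        + t * (z - w) * (t + 1) * (w * (z + b) * X - z * (w + b) * Y)"
      by (simp add: algebra_simps)
    also have "\<dots> = 0"
      unfolding DB DB' by (simp add: algebra_simps)
    finally show "t * (z - w) * ((w - t * b) * ((z - t * b) * E + (t + 1) * z * P) + (t + 1) * w * ((z + b) * X)
        - ((z - t * b) * ((w - t * b) * E + (t + 1) * w * Q) + (t + 1) * z * ((w + b) * Y))) = 0" .
  qed
  show "t * (z - w) * ((w + b) * (P + E))
      = (1 + t) * w * ((z + b) * X + ((z - t * b) * E + (t + 1) * z * P))
        - (z + t * w) * ((w + b) * Y + ((w - t * b) * E + (t + 1) * w * Q))"
  proof (rule cancel)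
    have "t * (z - w) * (t * (z - w) * ((w + b) * (P + E))
        - ((1 + t) * w * ((z + b) * X + ((z - t * b) * E + (t + 1) * z * P))
          - (z + t * w) * ((w + b) * Y + ((w - t * b) * E + (t + 1) * w * Q))))
      = (t * (z - w) * (w + b) - (1 + t) * (1 + t) * w * z) * (t * (z - w) * P)
        - (z + t * w) * (1 + t) * w * (t * (w - z) * Q)
        + t * (z - w) * (t * (z - w) * (w + b) * E - (1 + t) * w * (z + b) * X
          - (1 + t) * w * (z - t * b) * E + (z + t * w) * (w + b) * Y + (z + t * w) * (w - t * b) * E)"
      by (simp add: algebra_simps)
    also have "\<dots> = 0"
      unfolding DB DB' by (simp add: algebra_simps)
    finally show "t * (z - w) * (t * (z - w) * ((w + b) * (P + E))
        - ((1 + t) * w * ((z + b) * X + ((z - t * b) * E + (t + 1) * z * P))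
          - (z + t * w) * ((w + b) * Y + ((w - t * b) * E + (t + 1) * w * Q)))) = 0" .
  qed
  show "t * (z - w) * ((w - t * b) * (t * P) + (t + 1) * w * (K + X))
      = (1 + t) * w * (t * ((z - t * b) * X + (t + 1) * z * K))
        - (z + t * w) * (t * ((w - t * b) * Y + (t + 1) * w * K'))"
  proof -
    \<comment> \<open>Here \<open>P\<close> already carries the factor \<open>t * (z - w)\<close>,
      so \<open>DB\<close> applies directly and nothing has to be cancelled.\<close>
    have "t * (z - w) * ((w - t * b) * (t * P) + (t + 1) * w * (K + X))
      = (w - t * b) * t * (t * (z - w) * P) + t * (t + 1) * w * ((z - w) * X - (w + t * z) * K)
        + t * (t + 1) * w * ((1 + t) * z * K)"
      by (simp add: algebra_simps)
    also have "\<dots> = (1 + t) * w * (t * ((z - t * b) * X + (t + 1) * z * K))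
        - (z + t * w) * (t * ((w - t * b) * Y + (t + 1) * w * K'))"
      unfolding DB BB by (simp add: algebra_simps)
    finally show "t * (z - w) * ((w - t * b) * (t * P) + (t + 1) * w * (K + X))
      = (1 + t) * w * (t * ((z - t * b) * X + (t + 1) * z * K))
        - (z + t * w) * (t * ((w - t * b) * Y + (t + 1) * w * K'))" .
  qed
qed

section \<open>Hole lists, deletion of entries and products over pairs\<close>

text \<open>
  A basis state is a list whose head is the site of largest index, \<open>True\<close> being a particle. The
  entry \<open>holes l ! i\<close> is the exponent \<open>\<lambda>\<^sub>i\<^sub>+\<^sub>1 + N - (i + 1)\<close>, i.e. the position of the hole minus 1.
\<close>

primrec holes :: "bool list \<Rightarrow> nat list" where
  "holes [] = []"
| "holes (d # l) = (if d then holes l else length l # holes l)"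

lemma length_holes: "length (holes l) \<le> length l"
  by (induction l) auto

definition remove_nth :: "nat \<Rightarrow> 'b list \<Rightarrow> 'b list" where
  "remove_nth k xs = take k xs @ drop (Suc k) xs"

lemma remove_nth_Cons [simp]:
  "remove_nth 0 (x # xs) = xs"
  "remove_nth (Suc k) (x # xs) = x # remove_nth k xs"
  by (simp_all add: remove_nth_def)

lemma prod_list_remove_nth:
  fixes f :: "'b \<Rightarrow> 'c::comm_monoid_mult"
  assumes "k < length xs"
  shows "prod_list (map f xs) = f (xs ! k) * prod_list (map f (remove_nth k xs))"
  using assms
proof (induction xs arbitrary: k)
  case (Cons x xs)
  then show ?case by (cases k) (simp_all add: ac_simps)
qed simp

lemma distinct_remove_nth: "distinct xs \<Longrightarrow> distinct (remove_nth k xs)"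
  unfolding remove_nth_def by (simp add: set_take_disj_set_drop_if_distinct)

lemma length_remove_nth: "k < length xs \<Longrightarrow> length (remove_nth k xs) = length xs - 1"
  by (simp add: remove_nth_def)

lemma nth_remove_nth:
  "k < length xs \<Longrightarrow> i < length xs - 1 \<Longrightarrow> remove_nth k xs ! i = xs ! (if i < k then i else Suc i)"
  by (auto simp: remove_nth_def nth_append min_def)

primrec pairprod :: "('b \<Rightarrow> 'b \<Rightarrow> 'c::comm_monoid_mult) \<Rightarrow> 'b list \<Rightarrow> 'c" where
  "pairprod g [] = 1"
| "pairprod g (x # xs) = prod_list (map (g x) xs) * pairprod g xs"

text \<open>The theorem's double product has the larger index outermost, so the comparison with it
  peels off the last entry.\<close>

lemma pairprod_snoc: "pairprod g (xs @ [y]) = pairprod g xs * prod_list (map (\<lambda>x. g x y) xs)"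
  by (induction xs) (simp_all add: ac_simps)

lemma prod_list_map_upt: "prod_list (map f [1..<Suc n]) = (\<Prod>j = 1..n. f j)"
  by (induction n) simp_all

lemma pairprod_upt:
  "pairprod g (map z [1..<Suc n]) = (\<Prod>k = 1..n. \<Prod>j = 1..<k. g (z j) (z k))"
proof (induction n)
  case (Suc n)
  have "prod_list (map (\<lambda>x. g (z x) (z (Suc n))) [1..<Suc n]) = (\<Prod>j = 1..<Suc n. g (z j) (z (Suc n)))"
    by (simp only: prod_list_map_upt atLeastLessThanSuc_atLeastAtMost)
  then show ?case using Suc by (simp add: pairprod_snoc o_def)
qed simp

section \<open>Laplace expansion and partial fractions\<close>

text \<open>Deleting row 0 and column k leaves a matrix of the same form, without the exponent
  \<open>m\<close> and the variable \<open>zs ! k\<close>; the expansion is thus a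
  recursion.\<close>

lemma det_expand_first_row:
  fixes q :: "'b \<Rightarrow> 'c \<Rightarrow> 'd::comm_ring_1"
  assumes "length zs = Suc n"
  shows "det (mat (Suc n) (Suc n) (\<lambda>(i, k). q ((m # ms) ! i) (zs ! k)))
    = (\<Sum>k<Suc n. (-1) ^ k * q m (zs ! k) * det (mat n n (\<lambda>(i, j). q (ms ! i) (remove_nth k zs ! j))))"
proof -
  let ?A = "mat (Suc n) (Suc n) (\<lambda>(i, k). q ((m # ms) ! i) (zs ! k))"
  have "mat_delete ?A 0 k = mat n n (\<lambda>(i, j). q (ms ! i) (remove_nth k zs ! j))" if "k < Suc n" for k
    using that assms by (intro eq_matI) (auto simp: mat_delete_def nth_remove_nth)
  then show ?thesis
    by (subst laplace_expansion_row[of _ "Suc n" 0]) (auto simp: cofactor_def intro!: sum.cong)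
qed

text \<open>As a rational function of \<open>x\<close>, the right side tends to 1 at infinity and
  has simple poles at the entries of \<open>zs\<close>; the left side is its expansion. The proof is
  by induction on the number of poles.\<close>

lemma partial_fractions:
  fixes t :: "'a::field"
  assumes "distinct (x # zs)"
  shows "1 + (\<Sum>k<length zs. (1 + t) * zs ! k / (x - zs ! k)
      * (\<Prod>w\<leftarrow>remove_nth k zs. (zs ! k + t * w) / (zs ! k - w)))
    = (\<Prod>w\<leftarrow>zs. (x + t * w) / (x - w))"
  using assms
proof (induction zs arbitrary: x)
  case (Cons y zs)
  define A where "A = (\<lambda>k. (1 + t) * zs ! k * (\<Prod>w\<leftarrow>remove_nth k zs. (zs ! k + t * w) / (zs ! k - w)))"
  \<comment> \<open>The hypothesis is needed at \<open>x\<close> and also at the new pole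
    \<open>y\<close>, where it evaluates the residue.\<close>
  have IH: "(\<Prod>w\<leftarrow>zs. (u + t * w) / (u - w)) = 1 + (\<Sum>k<length zs. A k / (u - zs ! k))"
    if "u = x \<or> u = y" for u
    using Cons.IH[of u] Cons.prems that by (auto simp: A_def algebra_simps)
  have xy: "x - y \<noteq> 0" using Cons.prems by auto
  have "(1 + t) * y / (x - y) * (A k / (y - zs ! k)) + A k * ((zs ! k + t * y) / (zs ! k - y)) / (x - zs ! k)
      = (x + t * y) / (x - y) * (A k / (x - zs ! k))" if "k < length zs" for k
  proof -
    have "x - zs ! k \<noteq> 0" "y - zs ! k \<noteq> 0" "zs ! k - y \<noteq> 0"
      using Cons.prems that nth_mem[OF that] by auto
    then show ?thesis
      using xy by (simp add: divide_simps) (simp add: algebra_simps)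
  qed
  then have *: "(1 + t) * y / (x - y) * (\<Sum>k<length zs. A k / (y - zs ! k))
      + (\<Sum>k<length zs. A k * ((zs ! k + t * y) / (zs ! k - y)) / (x - zs ! k))
      = (x + t * y) / (x - y) * (\<Sum>k<length zs. A k / (x - zs ! k))"
    by (simp add: sum_distrib_left sum.distrib[symmetric])
  have Aeq: "(1 + t) * zs ! k / (x - zs ! k) * ((zs ! k + t * y) / (zs ! k - y)
      * (\<Prod>w\<leftarrow>remove_nth k zs. (zs ! k + t * w) / (zs ! k - w)))
    = A k * ((zs ! k + t * y) / (zs ! k - y)) / (x - zs ! k)" for k
    by (simp add: A_def ac_simps)
  have "1 + (\<Sum>k<length (y # zs). (1 + t) * (y # zs) ! k / (x - (y # zs) ! k)
      * (\<Prod>w\<leftarrow>remove_nth k (y # zs). ((y # zs) ! k + t * w) / ((y # zs) ! k - w)))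
    = 1 + (1 + t) * y / (x - y) * (1 + (\<Sum>k<length zs. A k / (y - zs ! k)))
      + (\<Sum>k<length zs. A k * ((zs ! k + t * y) / (zs ! k - y)) / (x - zs ! k))"
    by (simp only: length_Cons sum.lessThan_Suc_shift nth_Cons_0 nth_Cons_Suc remove_nth_Cons
        list.map(2) prod_list.Cons Aeq IH simp_thms add.assoc)
  also have "\<dots> = (1 + (1 + t) * y / (x - y)) + (x + t * y) / (x - y) * (\<Sum>k<length zs. A k / (x - zs ! k))"
    unfolding *[symmetric] by (simp add: distrib_left)
  also have "1 + (1 + t) * y / (x - y) = (x + t * y) / (x - y)"
    using xy by (simp add: field_simps)
  also have "(x + t * y) / (x - y) + (x + t * y) / (x - y) * (\<Sum>k<length zs. A k / (x - zs ! k))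
      = (\<Prod>w\<leftarrow>y # zs. (x + t * w) / (x - w))"
    by (simp add: IH distrib_left)
  finally show ?case .
qed simp

section \<open>Basis states as lists and the action of one L-operator on a row\<close>

primrec encode :: "nat \<Rightarrow> (nat \<Rightarrow> nat) \<Rightarrow> bool list" where
  "encode 0 s = []"
| "encode (Suc k) s = (s (Suc k) = 1) # encode k s"

text \<open>A right inverse of \<open>encode\<close> on lists of the right length. Sites above the
  list keep the values of \<open>s\<close>, since a partial chain of L-operators does not touch
  them.\<close>

primrec overwrite :: "bool list \<Rightarrow> (nat \<Rightarrow> nat) \<Rightarrow> nat \<Rightarrow> nat" where
  "overwrite [] s = s"
| "overwrite (d # m) s = (overwrite m s)(Suc (length m) := (if d then 1 else 0))"

lemma length_encode [simp]: "length (encode k s) = k"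
  by (induction k) simp_all

lemma overwrite_above: "length m < j \<Longrightarrow> overwrite m s j = s j"
  by (induction m) auto

lemma encode_cong: "(\<And>j. j \<le> k \<Longrightarrow> s j = s' j) \<Longrightarrow> encode k s = encode k s'"
  by (induction k) simp_all

lemma encode_overwrite: "length m = k \<Longrightarrow> encode k (overwrite m s) = m"
proof (induction m arbitrary: k)
  case (Cons d m)
  have "encode (length m) (overwrite (d # m) s) = encode (length m) (overwrite m s)"
    by (rule encode_cong) simp
  then have "encode (length m) (overwrite (d # m) s) = m" by (simp only: Cons.IH)
  then have "encode (Suc (length m)) (overwrite (d # m) s) = d # m"
    unfolding encode.simps(2) by simp
  then show ?case unfolding Cons.prems[symmetric] by (simp only: length_Cons)
qed simp

lemma False_in_encode: "False \<in> set (encode k s) \<longleftrightarrow> (\<exists>j\<in>{1..k}. s j \<noteq> 1)"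
  by (induction k) (auto simp: atLeastAtMostSuc_conv)

lemma holes_encode: "holes (encode k s) = map (\<lambda>j. j - 1) (filter (\<lambda>j. s j \<noteq> 1) (rev [1..<Suc k]))"
  by (induction k) simp_all

lemma finite_q_basis: "finite (q_basis M)"
  unfolding q_basis_def by (intro finite_PiE) auto

lemma sum_row_product:
  fixes u :: "'b \<Rightarrow> 'c::comm_ring_1"
  shows "(\<Sum>w\<in>A. u w * (\<Sum>b\<in>B. \<Sum>w'\<in>A. L w b w' * C b w'))
    = (\<Sum>b\<in>B. \<Sum>w'\<in>A. (\<Sum>w\<in>A. u w * L w b w') * C b w')"
proof -
  have "(\<Sum>w\<in>A. u w * (\<Sum>b\<in>B. \<Sum>w'\<in>A. L w b w' * C b w'))
    = (\<Sum>w\<in>A. \<Sum>b\<in>B. \<Sum>w'\<in>A. u w * L w b w' * C b w')"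
    by (simp add: sum_distrib_left mult.assoc)
  also have "\<dots> = (\<Sum>b\<in>B. \<Sum>w\<in>A. \<Sum>w'\<in>A. u w * L w b w' * C b w')"
    by (rule sum.swap)
  also have "\<dots> = (\<Sum>b\<in>B. \<Sum>w'\<in>A. \<Sum>w\<in>A. u w * L w b w' * C b w')"
    by (rule sum.cong[OF refl], rule sum.swap)
  finally show ?thesis
    by (simp add: sum_distrib_right)
qed

text \<open>The L-operator changes only site \<open>j\<close>, so at most the two states differing
  from \<open>w'\<close> there contribute.\<close>

lemma L_op_row:
  assumes "w' \<in> q_basis M" and "j \<in> {1..M}"
  shows "(\<Sum>w\<in>q_basis M. u w * L_op M z t c j (\<gamma>, w) (\<beta>, w'))
    = (\<Sum>\<delta>\<in>{0, 1}. L_elem z t c \<beta> (w' j) \<gamma> \<delta> * u (w'(j := \<delta>)))"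
proof -
  have "(\<Sum>w\<in>q_basis M. u w * L_op M z t c j (\<gamma>, w) (\<beta>, w'))
    = (\<Sum>w\<in>(\<lambda>\<delta>. w'(j := \<delta>)) ` {0, 1}. u w * L_op M z t c j (\<gamma>, w) (\<beta>, w'))"
  proof (rule sum.mono_neutral_right[OF finite_q_basis])
    show "(\<lambda>\<delta>. w'(j := \<delta>)) ` {0, 1} \<subseteq> q_basis M"
      using assms by (auto simp: q_basis_def PiE_iff extensional_def)
    show "\<forall>w\<in>q_basis M - (\<lambda>\<delta>. w'(j := \<delta>)) ` {0, 1}. u w * L_op M z t c j (\<gamma>, w) (\<beta>, w') = 0"
    proof
      fix w assume w: "w \<in> q_basis M - (\<lambda>\<delta>. w'(j := \<delta>)) ` {0, 1}"
      have "\<not> (\<forall>i\<in>{1..M} - {j}. w i = w' i)"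
      proof
        assume eq: "\<forall>i\<in>{1..M} - {j}. w i = w' i"
        \<comment> \<open>Outside \<open>{1..M}\<close> both states are \<open>undefined\<close> by
          extensionality, so agreement at the other sites determines \<open>w\<close> up to its
          value at \<open>j\<close>.\<close>
        have "w = w'(j := w j)"
        proof
          fix i
          have "w i = w' i" if "i \<notin> {1..M}"
            using w assms(1) PiE_arb[OF _ that] unfolding q_basis_def by (metis DiffD1)
          then show "w i = (w'(j := w j)) i"
            using eq by (cases "i = j") (metis fun_upd_same, metis DiffI fun_upd_other singletonD)
        qed
        moreover have "w j \<in> {0, 1}"
          using w assms(2) PiE_mem[of w "{1..M}" "\<lambda>_. {0, 1}" j] by (simp add: q_basis_def)
        ultimately show False using w by blast
      qed
      then show "u w * L_op M z t c j (\<gamma>, w) (\<beta>, w') = 0"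
        unfolding L_op_def by (simp only: prod.case if_False mult_zero_right)
    qed
  qed
  also have "\<dots> = (\<Sum>\<delta>\<in>{0, 1}. u (w'(j := \<delta>)) * L_op M z t c j (\<gamma>, w'(j := \<delta>)) (\<beta>, w'))"
    by (subst sum.reindex) (auto simp: inj_on_def dest: fun_upd_eqD)
  finally show ?thesis
    by (simp add: L_op_def mult.commute)
qed

section \<open>Row action of B and D, and its linearity\<close>

context
  fixes t :: "'a::field" and a :: "nat \<Rightarrow> 'a"
begin

text \<open>
  \<open>rowB z v\<close> and \<open>rowD z v\<close> are \<open>v B(z)\<close> and \<open>v D(z)\<close> for a row vector \<open>v\<close>; the number of sites is the
  length of the list argument. Since the operators act from the right, \<open>rowB w (rowB z v)\<close> is \<open>v B(z) B(w)\<close>.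
\<close>

fun rowB :: "'a \<Rightarrow> (bool list \<Rightarrow> 'a) \<Rightarrow> bool list \<Rightarrow> 'a"
  and rowD :: "'a \<Rightarrow> (bool list \<Rightarrow> 'a) \<Rightarrow> bool list \<Rightarrow> 'a" where
  "rowB z v [] = 0"
| "rowB z v (False # l) = rowB z (\<lambda>m. v (False # m)) l + rowD z (\<lambda>m. v (True # m)) l"
| "rowB z v (True # l) = t * rowB z (\<lambda>m. v (True # m)) l"
| "rowD z v [] = v []"
| "rowD z v (False # l) = (z + a (Suc (length l))) * rowD z (\<lambda>m. v (False # m)) l"
| "rowD z v (True # l) = (z - t * a (Suc (length l))) * rowD z (\<lambda>m. v (True # m)) l
     + (t + 1) * z * rowB z (\<lambda>m. v (False # m)) l"

lemma row_cong:
  assumes "\<And>m. length m = length l \<Longrightarrow> v m = v' m"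
  shows "rowB z v l = rowB z v' l" and "rowD z v l = rowD z v' l"
proof -
  have "rowB z v l = rowB z v' l \<and> rowD z v l = rowD z v' l"
    using assms
  proof (induction l arbitrary: v v')
    case (Cons d l)
    have "\<And>e. rowB z (\<lambda>m. v (e # m)) l = rowB z (\<lambda>m. v' (e # m)) l
             \<and> rowD z (\<lambda>m. v (e # m)) l = rowD z (\<lambda>m. v' (e # m)) l"
      by (rule Cons.IH) (simp add: Cons.prems)
    then show ?case by (cases d) simp_all
  qed simp
  then show "rowB z v l = rowB z v' l" and "rowD z v l = rowD z v' l" by simp_all
qed

lemma row_add:
  shows "rowB z (\<lambda>m. v m + v' m) l = rowB z v l + rowB z v' l"
    and "rowD z (\<lambda>m. v m + v' m) l = rowD z v l + rowD z v' l"
proof -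
  have "rowB z (\<lambda>m. v m + v' m) l = rowB z v l + rowB z v' l
      \<and> rowD z (\<lambda>m. v m + v' m) l = rowD z v l + rowD z v' l"
  proof (induction l arbitrary: v v')
    case (Cons d l)
    show ?case by (cases d) (simp_all add: Cons.IH algebra_simps)
  qed simp
  then show "rowB z (\<lambda>m. v m + v' m) l = rowB z v l + rowB z v' l"
    and "rowD z (\<lambda>m. v m + v' m) l = rowD z v l + rowD z v' l" by simp_all
qed

text \<open>The operators preserve the number of sites, so a factor depending only on it behaves
  like a constant. This covers the site-dependent coefficients and the eigenvalue of D.\<close>

lemma row_scale_length:
  shows "rowB z (\<lambda>m. f (length m) * v m) l = f (length l) * rowB z v l"
    and "rowD z (\<lambda>m. f (length m) * v m) l = f (length l) * rowD z v l"
proof -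
  have "rowB z (\<lambda>m. f (length m) * v m) l = f (length l) * rowB z v l
      \<and> rowD z (\<lambda>m. f (length m) * v m) l = f (length l) * rowD z v l"
  proof (induction l arbitrary: v f)
    case (Cons d l)
    \<comment> \<open>Splitting off the head shortens every argument by one, hence the shifted
      \<open>f\<close>.\<close>
    note IH = Cons.IH[of "\<lambda>n. f (Suc n)"]
    show ?case by (cases d) (simp_all add: IH algebra_simps)
  qed simp
  then show "rowB z (\<lambda>m. f (length m) * v m) l = f (length l) * rowB z v l"
    and "rowD z (\<lambda>m. f (length m) * v m) l = f (length l) * rowD z v l" by simp_all
qed

lemma row_scale:
  shows "rowB z (\<lambda>m. c * v m) l = c * rowB z v l"
    and "rowD z (\<lambda>m. c * v m) l = c * rowD z v l"
  using row_scale_length[of z "\<lambda>_. c"] by simp_all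

lemma row_zero:
  shows "rowB z (\<lambda>m. 0) l = 0" and "rowD z (\<lambda>m. 0) l = 0"
  using row_scale[of z 0] by simp_all

section \<open>Exchange relations\<close>

text \<open>The induction carries four relations at once, for all row vectors: BB, DD, and DB in
  both orders of z and w. Splitting off the last site mixes them through \<open>vT\<close> and
  \<open>vF\<close>.\<close>

lemma row_exchange:
  assumes "t \<noteq> 0" and "z \<noteq> w"
  shows "(w + t * z) * rowB w (rowB z v) l = (z + t * w) * rowB z (rowB w v) l"
    and "t * (z - w) * rowD w (rowB z v) l
      = (1 + t) * w * rowB w (rowD z v) l - (z + t * w) * rowB z (rowD w v) l"
proof -
  have "(w + t * z) * rowB w (rowB z v) l = (z + t * w) * rowB z (rowB w v) l
    \<and> rowD w (rowD z v) l = rowD z (rowD w v) l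
    \<and> t * (z - w) * rowD w (rowB z v) l
      = (1 + t) * w * rowB w (rowD z v) l - (z + t * w) * rowB z (rowD w v) l
    \<and> t * (w - z) * rowD z (rowB w v) l
      = (1 + t) * z * rowB z (rowD w v) l - (w + t * z) * rowB w (rowD z v) l"
  proof (induction l arbitrary: v)
    case Nil
    show ?case by (simp add: algebra_simps)
  next
    case (Cons d l)
    have nz: "t * (z - w) \<noteq> 0" using assms by simp
    have BB: "(w + t * z) * rowB w (rowB z u) l = (z + t * w) * rowB z (rowB w u) l"
      and DD: "rowD w (rowD z u) l = rowD z (rowD w u) l"
      and DB: "t * (z - w) * rowD w (rowB z u) l
        = (1 + t) * w * rowB w (rowD z u) l - (z + t * w) * rowB z (rowD w u) l"
      and DB': "t * (w - z) * rowD z (rowB w u) l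
        = (1 + t) * z * rowB z (rowD w u) l - (w + t * z) * rowB w (rowD z u) l" for u
      using Cons.IH[of u] by blast+
    define vT where "vT = (\<lambda>m. v (True # m))"
    define vF where "vF = (\<lambda>m. v (False # m))"
    define b where "b = a (Suc (length l))"
    note scale = row_scale_length[of _ "\<lambda>n. y + a (Suc n)" for y]
      row_scale_length[of _ "\<lambda>n. y - t * a (Suc n)" for y]
    note lin = row_add row_scale scale vT_def[symmetric] vF_def[symmetric] b_def[symmetric]
    have nz': "t * (w - z) \<noteq> 0" using assms by simp
    show ?case
    proof (cases d)
      case True
      have "(w + t * z) * rowB w (rowB z v) (True # l) = (z + t * w) * rowB z (rowB w v) (True # l)"
        using BB[of vT] by (simp add: lin)
      moreover have "rowD w (rowD z v) (True # l) = rowD z (rowD w v) (True # l)"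
        using exchange_algebra(2)[OF nz DB[of vF] DB'[of vF] BB[of vF], where b = b and E = "rowD w (rowD z vT) l"]
          DD[of vT] by (simp add: lin)
      moreover have "t * (z - w) * rowD w (rowB z v) (True # l)
          = (1 + t) * w * rowB w (rowD z v) (True # l) - (z + t * w) * rowB z (rowD w v) (True # l)"
        using exchange_algebra(4)[OF nz DB[of vT] DB'[of vT] BB[of vF], where b = b] by (simp add: lin)
      moreover have "t * (w - z) * rowD z (rowB w v) (True # l)
          = (1 + t) * z * rowB z (rowD w v) (True # l) - (w + t * z) * rowB w (rowD z v) (True # l)"
        using exchange_algebra(4)[OF nz' DB'[of vT] DB[of vT] BB[of vF, symmetric], where b = b] by (simp add: lin)
      ultimately show ?thesis using True by simp
    next
      case False
      have "(w + t * z) * rowB w (rowB z v) (False # l) = (z + t * w) * rowB z (rowB w v) (False # l)"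
        using exchange_algebra(1)[OF nz DB[of vT] DB'[of vT] BB[of vF]] by (simp add: lin add.assoc)
      moreover have "rowD w (rowD z v) (False # l) = rowD z (rowD w v) (False # l)"
        using DD[of vF] by (simp add: lin)
      moreover have "t * (z - w) * rowD w (rowB z v) (False # l)
          = (1 + t) * w * rowB w (rowD z v) (False # l) - (z + t * w) * rowB z (rowD w v) (False # l)"
        using exchange_algebra(3)[OF nz DB[of vF] DB'[of vF] BB[of vF], where b = b and E = "rowD w (rowD z vT) l"]
          DD[of vT] by (simp add: lin)
      moreover have "t * (w - z) * rowD z (rowB w v) (False # l)
          = (1 + t) * z * rowB z (rowD w v) (False # l) - (w + t * z) * rowB w (rowD z v) (False # l)"
        using exchange_algebra(3)[OF nz' DB'[of vF] DB[of vF] BB[of vF, symmetric], where b = b and E = "rowD w (rowD z vT) l"]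
          DD[of vT] by (simp add: lin)
      ultimately show ?thesis using False by simp
    qed
  qed
  then show "(w + t * z) * rowB w (rowB z v) l = (z + t * w) * rowB z (rowB w v) l"
    and "t * (z - w) * rowD w (rowB z v) l
      = (1 + t) * w * rowB w (rowD z v) l - (z + t * w) * rowB z (rowD w v) l" by blast+
qed

section \<open>Products of B-operators and splitting off the last site\<close>

definition rowBs :: "(bool list \<Rightarrow> 'a) \<Rightarrow> 'a list \<Rightarrow> bool list \<Rightarrow> 'a" where
  "rowBs v zs = foldl (\<lambda>u z. rowB z u) v zs"

lemma rowBs_simps [simp]:
  "rowBs v [] = v"
  "rowBs v (z # zs) = rowBs (rowB z v) zs"
  "rowBs v (zs @ [z]) = rowB z (rowBs v zs)"
  by (simp_all add: rowBs_def)

lemma rowBs_add: "rowBs (\<lambda>m. v m + v' m) zs l = rowBs v zs l + rowBs v' zs l"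
  by (induction zs arbitrary: v v') (simp_all add: row_add[THEN ext])

lemma rowBs_scale_length: "rowBs (\<lambda>m. f (length m) * v m) zs l = f (length l) * rowBs v zs l"
  by (induction zs arbitrary: v) (simp_all add: row_scale_length[of _ f, THEN ext])

lemma rowBs_scale: "rowBs (\<lambda>m. c * v m) zs l = c * rowBs v zs l"
  using rowBs_scale_length[of "\<lambda>_. c"] .

text \<open>
  \<open>rowS v [z\<^sub>1, \<dots>, z\<^sub>n]\<close> is \<open>\<Sum>\<^sub>k t\<^bsup>k-1\<^esup> v B(z\<^sub>1) \<cdots> D(z\<^sub>k) \<cdots> B(z\<^sub>n)\<close>: the factors to the left of \<open>D(z\<^sub>k)\<close> already see
  a particle at the last site, hence the powers of \<open>t\<close>.
\<close>

primrec rowS :: "(bool list \<Rightarrow> 'a) \<Rightarrow> 'a list \<Rightarrow> bool list \<Rightarrow> 'a" where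
  "rowS v [] = (\<lambda>l. 0)"
| "rowS v (z # zs) = (\<lambda>l. rowBs (rowD z v) zs l + t * rowS (rowB z v) zs l)"

lemma rowS_scale: "rowS (\<lambda>m. c * v m) zs l = c * rowS v zs l"
  by (induction zs arbitrary: v) (simp_all add: row_scale[THEN ext] rowBs_scale algebra_simps)

lemma rowBs_True: "rowBs v zs (True # l) = t ^ length zs * rowBs (\<lambda>m. v (True # m)) zs l"
  by (induction zs arbitrary: v) (simp_all add: rowBs_scale)

text \<open>Either the hole is already present in \<open>v\<close>, or exactly one factor acts as D
  on the remaining sites; \<open>rowS\<close> collects the second case.\<close>

lemma rowBs_False:
  "rowBs v zs (False # l) = rowBs (\<lambda>m. v (False # m)) zs l + rowS (\<lambda>m. v (True # m)) zs l"
  by (induction zs arbitrary: v) (simp_all add: rowBs_add rowS_scale)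

section \<open>Moving D to the left\<close>

text \<open>With y = \<open>zs ! k\<close>, this is the product of (u + t y) / (y - u) over the
  entries u before position k and of (y + t w) / (y - w) over the entries w after it.\<close>

primrec coef :: "'a list \<Rightarrow> nat \<Rightarrow> 'a" where
  "coef [] k = 0"
| "coef (z # zs) k = (case k of
      0 \<Rightarrow> (\<Prod>w\<leftarrow>zs. (z + t * w) / (z - w))
    | Suc j \<Rightarrow> (z + t * zs ! j) / (zs ! j - z) * coef zs j)"

text \<open>Moving B(y), y = \<open>zs ! k\<close>, from the front back to position k replaces each
  factor (u + t y) / (y - u) by (y + t u) / (y - u), so the coefficient becomes uniform in the other
  entries.\<close>

lemma coef_reorder:
  assumes "t \<noteq> 0" and "distinct zs" and "k < length zs"
  shows "coef zs k * rowBs (rowB (zs ! k) u) (remove_nth k zs) l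
    = (\<Prod>w\<leftarrow>remove_nth k zs. (zs ! k + t * w) / (zs ! k - w)) * rowBs u zs l"
  using assms(2,3)
proof (induction zs arbitrary: k u)
  case (Cons x zs)
  show ?case
  proof (cases k)
    case 0
    then show ?thesis by simp
  next
    case (Suc j)
    let ?y = "zs ! j"
    have "?y \<noteq> x" and j: "j < length zs" and d: "distinct zs"
      using Cons.prems Suc nth_mem[of j zs] by auto
    \<comment> \<open>The factor \<open>x + t * ?y\<close> stays attached: it is a numerator in
      \<open>coef\<close> and never has to be inverted.\<close>
    then have "(\<lambda>m. (x + t * ?y) * rowB x (rowB ?y u) m) = (\<lambda>m. (?y + t * x) * rowB ?y (rowB x u) m)"
      using row_exchange(1)[OF assms(1), of ?y x] by auto
    then have "(x + t * ?y) * rowBs (rowB x (rowB ?y u)) (remove_nth j zs) l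
      = (?y + t * x) * rowBs (rowB ?y (rowB x u)) (remove_nth j zs) l"
      by (metis rowBs_scale)
    then have "coef (x # zs) (Suc j) * rowBs (rowB ?y u) (remove_nth (Suc j) (x # zs)) l
      = (?y + t * x) / (?y - x) * (coef zs j * rowBs (rowB ?y (rowB x u)) (remove_nth j zs) l)"
      by (simp add: divide_simps)
    also have "\<dots> = (?y + t * x) / (?y - x) * ((\<Prod>w\<leftarrow>remove_nth j zs. (?y + t * w) / (?y - w)) * rowBs (rowB x u) zs l)"
      using Cons.IH[OF d j] by simp
    finally show ?thesis using Suc by (simp add: mult.assoc)
  qed
qed simp

text \<open>For a new first parameter \<open>x\<close>, each D(y) standing after B(x) is exchanged
  with it. The term keeping D(y) on the left gives the coefficient at \<open>Suc k\<close>; the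
  terms with D(x) on the left are all multiples of one vector by
  \<open>coef_reorder\<close>.\<close>

lemma rowS_eq:
  assumes "t \<noteq> 0" and "distinct zs"
  shows "rowS v zs l = (\<Sum>k<length zs. coef zs k * rowBs (rowD (zs ! k) v) (remove_nth k zs) l)"
  using assms(2)
proof (induction zs arbitrary: v)
  case (Cons x zs)
  have "t * (coef zs k * rowBs (rowD (zs ! k) (rowB x v)) (remove_nth k zs) l)
      = (1 + t) * zs ! k / (x - zs ! k) * (\<Prod>w\<leftarrow>remove_nth k zs. (zs ! k + t * w) / (zs ! k - w)) * rowBs (rowD x v) zs l
        + coef (x # zs) (Suc k) * rowBs (rowD (zs ! k) v) (remove_nth (Suc k) (x # zs)) l"
    if k: "k < length zs" for k
  proof -
    let ?y = "zs ! k" and ?r = "remove_nth k zs"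
    have ne: "x \<noteq> ?y" and d: "distinct zs" using Cons.prems k nth_mem[OF k] by auto
    have "t * (x - ?y) * rowBs (rowD ?y (rowB x v)) ?r l
      = rowBs (\<lambda>m. t * (x - ?y) * rowD ?y (rowB x v) m) ?r l"
      by (rule rowBs_scale[symmetric])
    also have "\<dots> = rowBs (\<lambda>m. (1 + t) * ?y * rowB ?y (rowD x v) m + (- (x + t * ?y)) * rowB x (rowD ?y v) m) ?r l"
      unfolding row_exchange(2)[OF assms(1) ne] by (simp add: algebra_simps)
    also have "\<dots> = (1 + t) * ?y * rowBs (rowB ?y (rowD x v)) ?r l - (x + t * ?y) * rowBs (rowB x (rowD ?y v)) ?r l"
      by (simp only: rowBs_add rowBs_scale) (simp add: algebra_simps)
    finally have "t * rowBs (rowD ?y (rowB x v)) ?r l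
      = ((1 + t) * ?y * rowBs (rowB ?y (rowD x v)) ?r l - (x + t * ?y) * rowBs (rowB x (rowD ?y v)) ?r l) / (x - ?y)"
      using ne by (simp add: field_simps)
    moreover have "c * ((A * U - B * V) / D) = A / D * (c * U) - B / D * c * V" for A B c D U V :: 'a
      by (simp add: diff_divide_distrib right_diff_distrib ac_simps)
    ultimately have "t * (coef zs k * rowBs (rowD ?y (rowB x v)) ?r l) =
      (1 + t) * ?y / (x - ?y) * (coef zs k * rowBs (rowB ?y (rowD x v)) ?r l)
      - (x + t * ?y) / (x - ?y) * coef zs k * rowBs (rowB x (rowD ?y v)) ?r l"
      by (simp only: mult.left_commute[of t "coef zs k"])
    moreover have "- ((x + t * ?y) / (x - ?y)) = (x + t * ?y) / (?y - x)"
      by (metis minus_diff_eq minus_divide_right)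
    ultimately have "t * (coef zs k * rowBs (rowD ?y (rowB x v)) ?r l) =
      (1 + t) * ?y / (x - ?y) * (coef zs k * rowBs (rowB ?y (rowD x v)) ?r l)
      + (x + t * ?y) / (?y - x) * coef zs k * rowBs (rowB x (rowD ?y v)) ?r l"
      by (metis add_uminus_conv_diff mult_minus_left)
    then show ?thesis
      unfolding coef_reorder[OF assms(1) d k] by (simp add: mult.assoc)
  qed
  then have "rowS v (x # zs) l = (1 + (\<Sum>k<length zs. (1 + t) * zs ! k / (x - zs ! k)
      * (\<Prod>w\<leftarrow>remove_nth k zs. (zs ! k + t * w) / (zs ! k - w)))) * rowBs (rowD x v) zs l
      + (\<Sum>k<length zs. coef (x # zs) (Suc k) * rowBs (rowD (zs ! k) v) (remove_nth (Suc k) (x # zs)) l)"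
    using Cons.prems by (simp add: Cons.IH sum_distrib_left sum_distrib_right sum.distrib algebra_simps del: coef.simps remove_nth_Cons)
  then show ?case
    \<comment> \<open>The multiples of v D(x) B(z_1) ... B(z_n), z_i the entries of
      \<open>zs\<close>, add up to \<open>coef (x # zs) 0\<close>.\<close>
    unfolding partial_fractions[OF Cons.prems]
    by (simp add: sum.lessThan_Suc_shift del: sum.lessThan_Suc)
qed simp

text \<open>Each of the \<open>length zs - 1\<close> factors of \<open>coef\<close> takes one t and
  becomes a factor \<open>r\<close>. The k factors from earlier entries change sign, which yields
  the Laplace sign.\<close>

lemma coef_pairprod:
  assumes "t \<noteq> 0" and "distinct zs" and "k < length zs"
  defines "r \<equiv> \<lambda>x y. (x + t * y) / (x / t - y / t)"
  shows "t ^ (length zs - 1) * coef zs k * pairprod r (remove_nth k zs) = (-1) ^ k * pairprod r zs"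
  using assms(2,3)
proof (induction zs arbitrary: k)
  case (Cons x zs)
  have r: "r u w = t * ((u + t * w) / (u - w))" for u w
    using assms(1) by (simp add: r_def diff_divide_distrib[symmetric])
  show ?case
  proof (cases k)
    case 0
    have "prod_list (map (r x) zs) = t ^ length zs * (\<Prod>w\<leftarrow>zs. (x + t * w) / (x - w))"
      unfolding r by (induction zs) simp_all
    then show ?thesis using 0 by simp
  next
    case (Suc j)
    let ?y = "zs ! j"
    have j: "j < length zs" and d: "distinct zs" using Cons.prems Suc by auto
    then obtain n where n: "length zs = Suc n" by (cases "length zs") auto
    have neg: "t * ((x + t * ?y) / (?y - x)) = - r x ?y"
      unfolding r by (metis minus_diff_eq minus_divide_right mult_minus_right)
    have "t ^ (length (x # zs) - 1) * coef (x # zs) (Suc j) * pairprod r (remove_nth (Suc j) (x # zs))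
      = (t * ((x + t * ?y) / (?y - x))) * prod_list (map (r x) (remove_nth j zs))
        * (t ^ (length zs - 1) * coef zs j * pairprod r (remove_nth j zs))"
      by (simp add: n)
    also have "\<dots> = - r x ?y * prod_list (map (r x) (remove_nth j zs)) * ((-1) ^ j * pairprod r zs)"
      by (simp only: Cons.IH[OF d j] neg)
    also have "\<dots> = (-1) ^ Suc j * pairprod r (x # zs)"
      by (simp add: prod_list_remove_nth[OF j, of "r x"])
    finally show ?thesis by (simp only: Suc)
  qed
qed simp

section \<open>Determinant formula for the filled row vector\<close>

definition full :: "bool list \<Rightarrow> 'a" where
  "full l = (if False \<in> set l then 0 else 1)"

lemma full_simps [simp]: "full [] = 1" "full (False # l) = 0" "full (True # l) = full l"
  by (simp_all add: full_def)

text \<open>At a particle the \<open>rowB\<close> term acts on the hole component of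
  \<open>full\<close>, which is zero.\<close>

lemma rowD_full: "rowD z full l = (\<Prod>j = 1..length l. z - t * a j) * full l"
proof (induction l)
  case (Cons d l)
  then show ?case by (cases d) (simp_all add: row_zero ac_simps)
qed simp

text \<open>Induction on the sites: a particle only raises the power of t, while a hole at the last
  site adds a first row to the determinant, with exponent \<open>length l\<close>.\<close>

lemma rowBs_full:
  assumes "t \<noteq> 0" and "distinct zs" and "length (holes l) = length zs"
  defines "r \<equiv> \<lambda>x y. (x + t * y) / (x / t - y / t)"
    and "q \<equiv> \<lambda>m z. \<Prod>j = 1..m. z / t - a j"
  shows "rowBs full zs l = t ^ (length zs * (length l - length zs)) * pairprod r zs
    * det (mat (length zs) (length zs) (\<lambda>(i, k). q (holes l ! i) (zs ! k)))"
  using assms(2,3)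
proof (induction l arbitrary: zs)
  case Nil
  then show ?case by (simp add: det_dim_zero)
next
  case (Cons d l)
  show ?case
  proof (cases d)
    case True
    then have len: "length zs = length (holes l)" using Cons.prems by simp
    then have "length zs \<le> length l" using length_holes[of l] by simp
    then have "length zs + length zs * (length l - length zs) = length zs * (Suc (length l) - length zs)"
      by (simp add: Suc_diff_le)
    then show ?thesis
      using True Cons.IH[OF Cons.prems(1) len[symmetric]]
      by (simp add: rowBs_True power_add[symmetric] mult.assoc[symmetric])
  next
    case False
    then obtain n where n: "length zs = Suc n" and len: "length (holes l) = n"
      using Cons.prems by auto
    have le: "n \<le> length l" using length_holes[of l] len by simp
    let ?d = "\<lambda>k. det (mat n n (\<lambda>(i, j). q (holes l ! i) (remove_nth k zs ! j)))"
    have "coef zs k * rowBs (rowD (zs ! k) full) (remove_nth k zs) l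
      = t ^ (Suc n * (length l - n)) * pairprod r zs * ((-1) ^ k * q (length l) (zs ! k) * ?d k)"
      if k: "k < length zs" for k
    proof -
      let ?z = "zs ! k"
      \<comment> \<open>Pulling t out of every factor of the eigenvalue produces the rescaled
        arguments z/t.\<close>
      have "(\<Prod>j = 1..i. ?z - t * a j) = t ^ i * q i ?z" for i
      proof -
        have "?z - t * a j = t * (?z / t - a j)" for j
          using assms(1) by (simp add: right_diff_distrib)
        then show ?thesis by (simp add: q_def prod.distrib)
      qed
      then have "rowD ?z full = (\<lambda>m. t ^ length m * q (length m) ?z * full m)"
        by (intro ext) (simp only: rowD_full)
      then have "rowBs (rowD ?z full) (remove_nth k zs) l = t ^ length l * q (length l) ?z * rowBs full (remove_nth k zs) l"
        using rowBs_scale_length[of "\<lambda>i. t ^ i * q i ?z" full "remove_nth k zs" l] by simp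
      also have "rowBs full (remove_nth k zs) l = t ^ (n * (length l - n)) * pairprod r (remove_nth k zs) * ?d k"
        using Cons.IH[of "remove_nth k zs"] Cons.prems(1) k len n by (simp add: distinct_remove_nth length_remove_nth)
      finally have "rowBs (rowD ?z full) (remove_nth k zs) l = t ^ length l * q (length l) ?z
        * (t ^ (n * (length l - n)) * pairprod r (remove_nth k zs) * ?d k)" .
      \<comment> \<open>Of the power \<open>t ^ length l\<close>, the part \<open>t ^ n\<close> is
        used up by \<open>coef_pairprod\<close>; the rest raises n (length l - n) to (n + 1) (length
        l - n).\<close>
      moreover obtain e where e: "length l = n + e"
        using le le_Suc_ex by blast
      ultimately have expand: "coef zs k * rowBs (rowD ?z full) (remove_nth k zs) l =
        t ^ (length l - n + n * (length l - n)) * (t ^ n * coef zs k * pairprod r (remove_nth k zs)) * (q (length l) ?z * ?d k)"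
        by (simp add: e power_add)
      have "t ^ n * coef zs k * pairprod r (remove_nth k zs) = (-1) ^ k * pairprod r zs"
        using coef_pairprod[OF assms(1) Cons.prems(1) k] by (simp only: n diff_Suc_1 r_def)
      then show ?thesis
        unfolding expand by (simp add: ac_simps)
    qed
    then have "rowS full zs l = t ^ (Suc n * (length l - n)) * pairprod r zs *
      (\<Sum>k<Suc n. (-1) ^ k * q (length l) (zs ! k) * ?d k)"
      by (simp add: rowS_eq[OF assms(1) Cons.prems(1)] n sum_distrib_left del: sum.lessThan_Suc)
    also have "\<dots> = t ^ (Suc n * (length l - n)) * pairprod r zs
      * det (mat (Suc n) (Suc n) (\<lambda>(i, k). q ((length l # holes l) ! i) (zs ! k)))"
      by (simp only: det_expand_first_row[OF n])
    \<comment> \<open>The first summand of \<open>rowBs_False\<close> vanishes because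
      \<open>full\<close> has no hole component.\<close>
    finally show ?thesis
      using False n by (simp add: rowBs_False rowBs_scale[of 0, simplified])
  qed
qed

section \<open>From operator matrix elements to the row recursions\<close>

text \<open>The outermost L-operator, at site \<open>Suc k\<close>, meets the row vector first; this
  is the site split off by \<open>rowB\<close> and \<open>rowD\<close>. Auxiliary input 1 is fixed,
  and the output selects B or D.\<close>

lemma L_chain_row:
  assumes "s \<in> q_basis M" and "k \<le> M" and "\<gamma> \<in> {0, 1}"
  shows "(\<Sum>w\<in>q_basis M. u w * L_chain M z t a k (\<gamma>, w) (1, s))
    = (if \<gamma> = 0 then rowB else rowD) z (\<lambda>m. u (overwrite m s)) (encode k s)"
  using assms(2,3)
proof (induction k arbitrary: u \<gamma>)
  case 0
  have "(\<Sum>w\<in>q_basis M. u w * L_chain M z t a 0 (\<gamma>, w) (1, s))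
    = (\<Sum>w\<in>q_basis M. if w = s then (if \<gamma> = 1 then u s else 0) else 0)"
    by (rule sum.cong) (auto simp: op_id_def)
  then show ?case using 0 assms(1) by (auto simp: finite_q_basis)
next
  case (Suc k)
  define b where "b = s (Suc k)"
  have b: "b \<in> {0, 1}"
    using PiE_mem[OF assms(1)[unfolded q_basis_def], of "Suc k"] Suc.prems(1) by (simp add: b_def)
  define v where "v = (\<lambda>(\<delta>::nat) m. u (overwrite ((\<delta> = 1) # m) s))"
  let ?row = "\<lambda>\<beta>. (if \<beta> = (0::nat) then rowB else rowD)"
  have step: "(\<Sum>w'\<in>q_basis M. (\<Sum>w\<in>q_basis M. u w * L_op M z t (a (Suc k)) (Suc k) (\<gamma>, w) (\<beta>, w'))
        * L_chain M z t a k (\<beta>, w') (1, s))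
      = (\<Sum>\<delta>\<in>{0, 1}. L_elem z t (a (Suc k)) \<beta> b \<gamma> \<delta> * ?row \<beta> z (v \<delta>) (encode k s))"
    if \<beta>: "\<beta> \<in> {0, 1}" for \<beta> :: nat
  proof -
    let ?u = "\<lambda>w'. \<Sum>\<delta>\<in>{0, 1}. L_elem z t (a (Suc k)) \<beta> (w' (Suc k)) \<gamma> \<delta> * u (w'(Suc k := \<delta>))"
    have "(\<Sum>w'\<in>q_basis M. (\<Sum>w\<in>q_basis M. u w * L_op M z t (a (Suc k)) (Suc k) (\<gamma>, w) (\<beta>, w'))
        * L_chain M z t a k (\<beta>, w') (1, s))
      = (\<Sum>w'\<in>q_basis M. ?u w' * L_chain M z t a k (\<beta>, w') (1, s))"
      using Suc.prems by (intro sum.cong refl) (simp add: L_op_row)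
    also have "\<dots> = ?row \<beta> z (\<lambda>m. ?u (overwrite m s)) (encode k s)"
      using Suc.IH[of \<beta> ?u] Suc.prems \<beta> by simp
    also have "\<dots> = ?row \<beta> z (\<lambda>m. L_elem z t (a (Suc k)) \<beta> b \<gamma> 0 * v 0 m
        + L_elem z t (a (Suc k)) \<beta> b \<gamma> 1 * v 1 m) (encode k s)"
      by (auto intro!: row_cong simp: overwrite_above b_def v_def)
    also have "\<dots> = (\<Sum>\<delta>\<in>{0, 1}. L_elem z t (a (Suc k)) \<beta> b \<gamma> \<delta> * ?row \<beta> z (v \<delta>) (encode k s))"
      by (simp add: row_add row_scale)
    finally show ?thesis .
  qed
  have chain: "L_chain M z t a (Suc k) (\<gamma>, w) (1, s) = (\<Sum>\<beta>\<in>{0, 1}. \<Sum>w'\<in>q_basis M.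
      L_op M z t (a (Suc k)) (Suc k) (\<gamma>, w) (\<beta>, w') * L_chain M z t a k (\<beta>, w') (1, s))" for w
    unfolding L_chain.simps(2) op_mult_def aq_basis_def by (rule sum.cartesian_product')
  have "(\<Sum>w\<in>q_basis M. u w * L_chain M z t a (Suc k) (\<gamma>, w) (1, s))
    = (\<Sum>\<beta>\<in>{0, 1}. \<Sum>w'\<in>q_basis M. (\<Sum>w\<in>q_basis M.
        u w * L_op M z t (a (Suc k)) (Suc k) (\<gamma>, w) (\<beta>, w')) * L_chain M z t a k (\<beta>, w') (1, s))"
    unfolding chain by (rule sum_row_product)
  also have "\<dots> = (\<Sum>\<beta>\<in>{0, 1}. \<Sum>\<delta>\<in>{0, 1}. L_elem z t (a (Suc k)) \<beta> b \<gamma> \<delta> * ?row \<beta> z (v \<delta>) (encode k s))"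
    by (rule sum.cong[OF refl], rule step)
  \<comment> \<open>The six nonzero entries of L reproduce the recursion clauses of
    \<open>rowB\<close> and \<open>rowD\<close>.\<close>
  also have "\<dots> = ?row \<gamma> z (\<lambda>m. u (overwrite m s)) (encode (Suc k) s)"
    using b Suc.prems(2) by (auto simp: L_elem_def v_def b_def[symmetric])
  finally show ?case .
qed

lemma B_op_row:
  assumes "s \<in> q_basis M"
  shows "(\<Sum>w\<in>q_basis M. v (encode M w) * B_op M z t a w s) = rowB z v (encode M s)"
proof -
  have "(\<Sum>w\<in>q_basis M. v (encode M w) * B_op M z t a w s)
    = rowB z (\<lambda>m. v (encode M (overwrite m s))) (encode M s)"
    using L_chain_row[OF assms order_refl, of 0 "\<lambda>w. v (encode M w)" z] by (simp add: B_op_def)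
  also have "\<dots> = rowB z v (encode M s)"
    by (rule row_cong) (simp add: encode_overwrite)
  finally show ?thesis .
qed

lemma B_prod_row:
  assumes "s \<in> q_basis M"
  shows "B_prod M z t a n (full_state M) s = rowBs full (map z [1..<Suc n]) (encode M s)"
  using assms
proof (induction n arbitrary: s)
  case 0
  have "full_state M = s \<longleftrightarrow> (\<forall>j\<in>{1..M}. s j = 1)"
  proof
    assume "\<forall>j\<in>{1..M}. s j = 1"
    then show "full_state M = s"
      using 0 unfolding q_basis_def
      by (intro PiE_ext[of "full_state M" "{1..M}" "\<lambda>_. {0, 1}"]) (auto simp: full_state_def)
  qed (auto simp: full_state_def)
  then show ?case by (auto simp: op_id_def full_def False_in_encode)
next
  case (Suc n)
  then show ?case
    by (simp add: op_mult_def B_op_row)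
qed

end

section \<open>Hole positions and the final identification\<close>

text \<open>This excludes truncation of the natural subtraction in
  \<open>hole_partition\<close>.\<close>

lemma strict_mono_on_ge:
  fixes x :: "nat \<Rightarrow> nat"
  assumes "strict_mono_on {1..N} x" and "x ` {1..N} \<subseteq> {1..M}"
  shows "1 \<le> i \<Longrightarrow> i \<le> N \<Longrightarrow> i \<le> x i"
proof (induction i rule: nat_induct_at_least)
  case base
  then have "x 1 \<in> x ` {1..N}" by auto
  then show ?case using assms(2) by auto
next
  case (Suc i)
  then have "x i < x (Suc i)" by (intro strict_mono_onD[OF assms(1)]) auto
  then show ?case using Suc by simp
qed

text \<open>Before reversal both lists are sorted and distinct with the same elements, hence
  equal.\<close>

lemma holes_hole_state:
  assumes "strict_mono_on {1..N} x" and "x ` {1..N} \<subseteq> {1..M}"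
  shows "holes (encode M (hole_state M N x)) = map (\<lambda>j. j - 1) (rev (map x [1..<Suc N]))"
proof -
  have "filter (\<lambda>j. hole_state M N x j \<noteq> 1) [1..<Suc M] = map x [1..<Suc N]"
  proof (rule sorted_distinct_set_unique)
    show "sorted (map x [1..<Suc N])"
      unfolding sorted_iff_nth_mono
      by (auto intro!: strict_mono_on_leD[OF assms(1)] simp del: upt_Suc)
    show "distinct (map x [1..<Suc N])"
      using strict_mono_on_imp_inj_on[OF assms(1)]
      by (simp add: distinct_map atLeastLessThanSuc_atLeastAtMost del: upt_Suc)
    show "set (filter (\<lambda>j. hole_state M N x j \<noteq> 1) [1..<Suc M]) = set (map x [1..<Suc N])"
      using assms(2) by (auto simp: hole_state_def atLeastLessThanSuc_atLeastAtMost simp del: upt_Suc)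
  qed (simp_all add: sorted_wrt_filter del: upt_Suc)
  then show ?thesis
    unfolding holes_encode rev_filter[symmetric] by (simp only:)
qed

theorem theorem7p3:
  fixes N M :: nat
    and z \<alpha> :: "nat \<Rightarrow> 'a::field_char_0"
    and t :: 'a
    and x :: "nat \<Rightarrow> nat"
  assumes "1 \<le> N" and "N \<le> M"
    and "t \<noteq> 0"
    and "inj_on z {1..N}"
    and "strict_mono_on {1..N} x" and "x ` {1..N} \<subseteq> {1..M}"
  shows "dual_wavefunction M N z t \<alpha> x =
    t ^ (N * (M - N)) * (\<Prod>k=1..N. \<Prod>j=1..<k. z j + t * z k) *
    factorial_schur N (hole_partition N x) (\<lambda>j. z j / t) (\<lambda>j. - \<alpha> j)"
proof -
  define q where "q = (\<lambda>m z. \<Prod>j = 1..m. z / t - \<alpha> j)"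
  let ?zs = "map z [1..<Suc N]" and ?l = "encode M (hole_state M N x)"
  have holes: "holes ?l = map (\<lambda>j. j - 1) (rev (map x [1..<Suc N]))"
    by (rule holes_hole_state[OF assms(5,6)])
  have "hole_state M N x \<in> q_basis M"
    by (auto simp: hole_state_def q_basis_def)
  then have "dual_wavefunction M N z t \<alpha> x = rowBs t \<alpha> full ?zs ?l"
    unfolding dual_wavefunction_def by (rule B_prod_row)
  also have "\<dots> = t ^ (N * (M - N)) * pairprod (\<lambda>x y. (x + t * y) / (x / t - y / t)) ?zs
      * det (mat N N (\<lambda>(i, k). q (holes ?l ! i) (?zs ! k)))"
  proof -
    have "distinct ?zs"
      using assms(4) by (simp add: distinct_map atLeastLessThanSuc_atLeastAtMost del: upt_Suc)
    moreover have "length (holes ?l) = length ?zs" by (simp add: holes)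
    moreover have "length ?zs = N" by simp
    ultimately show ?thesis
      using rowBs_full[OF assms(3), of ?zs ?l \<alpha>] unfolding q_def by (simp only: length_encode)
  qed
  \<comment> \<open>The denominators form the Vandermonde product in the variables z/t.\<close>
  also have "pairprod (\<lambda>x y. (x + t * y) / (x / t - y / t)) ?zs
      = (\<Prod>k=1..N. \<Prod>j=1..<k. z j + t * z k) / (\<Prod>k=1..N. \<Prod>j=1..<k. z j / t - z k / t)"
    by (simp only: pairprod_upt prod_dividef)
  also have "det (mat N N (\<lambda>(i, k). q (holes ?l ! i) (?zs ! k)))
      = factorial_F N (\<lambda>i. hole_partition N x i + (N - i)) (\<lambda>j. z j / t) (\<lambda>j. - \<alpha> j)"
    unfolding factorial_F_def
  proof (intro arg_cong[where f = det] eq_matI)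
    fix i k assume "i < dim_row (mat N N (\<lambda>(i, k). \<Prod>j = 1..hole_partition N x (i + 1) + (N - (i + 1)). z (k + 1) / t + - \<alpha> j))"
      and "k < dim_col (mat N N (\<lambda>(i, k). \<Prod>j = 1..hole_partition N x (i + 1) + (N - (i + 1)). z (k + 1) / t + - \<alpha> j))"
    then have ik: "i < N" "k < N" by simp_all
    have "rev (map x [1..<Suc N]) ! i = x (N - i)"
      using ik by (simp add: rev_nth Suc_diff_Suc del: upt_Suc)
    then have "holes ?l ! i = x (N - i) - 1"
      using ik by (simp add: holes del: upt_Suc)
    \<comment> \<open>Row i, counted from 0, belongs to the part with index i + 1; adding the
      staircase entry N - (i + 1) leaves the hole position minus 1.\<close>
    also have "\<dots> = hole_partition N x (i + 1) + (N - (i + 1))"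
    proof -
      have "N - i \<le> x (N - i)"
        using strict_mono_on_ge[OF assms(5,6)] ik by simp
      moreover have "N - (i + 1) + 1 = N - i" using ik by simp
      ultimately show ?thesis unfolding hole_partition_def using ik by simp
    qed
    finally show "mat N N (\<lambda>(i, k). q (holes ?l ! i) (?zs ! k)) $$ (i, k)
      = mat N N (\<lambda>(i, k). \<Prod>j = 1..hole_partition N x (i + 1) + (N - (i + 1)). z (k + 1) / t + - \<alpha> j) $$ (i, k)"
      using ik by (simp add: q_def del: upt_Suc)
  qed simp_all
  finally show ?thesis
    by (simp add: factorial_schur_def)
qed

end
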